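(* For every integer $n\ge 1$, $$\mathrm{pf}_n(123,132,312)=\mathrm{pf}_n(123,213,231)=\mathrm{pf}_n(123,231,312)=\binom{n+1}{2}.$$
   Context: A Dyck path of semilength $n$ is a lattice path from $(0,0)$ to $(n,n)$ consisting of $n$ north steps $N=(0,1)$ and $n$ east steps $E=(1,0)$ that never goes below the line $y=x$. A parking function of size $n$ is a Dyck path of semilength $n$ whose $n$ north steps are labeled bijectively by $\{1,\dots,n\}$ so that whenever two north steps are consecutive in the path (one immediately following the other), the label of the later one is larger. For a parking function $p$ of size $n$, $\phi(p)$ is the permutation of $\{1,\dots,n\}$ (in one-line notation) obtained by reading the labels of the north steps in the order they occur along the path. A permutation $\pi$ of $\{1,\dots,n\}$ contains a permutation $\rho$ of $\{1,\dots,m\}$ if there are indices $1\le i_1<\cdots<i_m\le n$ such that $\pi_{i_a}\le\pi_{i_b}$ if and only if $\rho_a\le\rho_b$; otherwise $\pi$ avoids $\rho$. For permutations $\rho_1,\dots,\rho_r$, $\mathrm{pf}_n(\rho_1,\dots,\rho_r)$ denotes the number of parking functions $p$ of size $n$ such that $\phi(p)$ avoids each of $\rho_1,\dots,\rho_r$. *)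

theory Defs imports Main begin

text \<open>
  A step carries a label exactly when it is a north step. Unlabelled lattice paths
  starting at the origin are lists of type \<open>unit step list\<close>.
\<close>

datatype 'a step = North 'a | East

type_synonym path = "unit step list"

text \<open>
  After the first \<open>k\<close> steps the path is at the point whose coordinates are the numbers
  of east and of north steps among them.
\<close>

definition dyck_path :: "nat \<Rightarrow> path \<Rightarrow> bool" where
  "dyck_path n w \<longleftrightarrow>
     count_list w (North ()) = n \<and> count_list w East = n \<and>
     (\<forall>k\<le>length w. count_list (take k w) East \<le> count_list (take k w) (North ()))"

definition underlying_path :: "'a step list \<Rightarrow> path" where
  "underlying_path p = map (map_step (\<lambda>_. ())) p"

fun north_labels :: "'a step list \<Rightarrow> 'a list" where
  "north_labels [] = []"
| "north_labels (North a # p) = a # north_labels p"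
| "north_labels (East # p) = north_labels p"

definition parking_function :: "nat \<Rightarrow> nat step list \<Rightarrow> bool" where
  "parking_function n p \<longleftrightarrow>
     dyck_path n (underlying_path p) \<and>
     distinct (north_labels p) \<and> set (north_labels p) = {1..n} \<and>
     (\<forall>i a b. Suc i < length p \<longrightarrow> p ! i = North a \<longrightarrow> p ! Suc i = North b \<longrightarrow> a < b)"

text \<open>Permutations are lists in one-line notation.\<close>

definition phi :: "nat step list \<Rightarrow> nat list" where
  "phi p = north_labels p"

definition contains :: "nat list \<Rightarrow> nat list \<Rightarrow> bool" where
  "contains \<pi> \<rho> \<longleftrightarrow>
     (\<exists>i :: nat \<Rightarrow> nat.
        strict_mono_on {..<length \<rho>} i \<and>
        (\<forall>a<length \<rho>. i a < length \<pi>) \<and>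
        (\<forall>a<length \<rho>. \<forall>b<length \<rho>. \<pi> ! i a \<le> \<pi> ! i b \<longleftrightarrow> \<rho> ! a \<le> \<rho> ! b))"

definition avoids :: "nat list \<Rightarrow> nat list \<Rightarrow> bool" where
  "avoids \<pi> \<rho> \<longleftrightarrow> \<not> contains \<pi> \<rho>"

definition pf :: "nat \<Rightarrow> nat list set \<Rightarrow> nat" where
  "pf n R = card {p. parking_function n p \<and> (\<forall>\<rho>\<in>R. avoids (phi p) \<rho>)}"

end

theory Submission imports Defs begin

text \<open>
  In each of the three classes the avoiding permutations are \<open>\<sigma>\<^sub>1, \<dots>, \<sigma>\<^sub>n\<close>, where
  \<open>\<sigma>\<^sub>i\<close> has its only ascent between its \<open>i\<close>-th and \<open>(i+1)\<close>-th entries, and \<open>\<sigma>\<^sub>n\<close> is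
  decreasing. In a parking function that reads \<open>\<sigma>\<^sub>i\<close> every descent forces an east step,
  so the first \<open>i - 1\<close> north steps are followed by exactly one east step each. The only
  freedom is where the surplus east step goes if none is taken at the ascent, which
  gives \<open>n - i + 1\<close> parking functions. Summing over \<open>i\<close> yields \<open>n + (n - 1) + \<dots> + 1\<close>.
\<close>

section \<open>Parking functions as labelled ballot words\<close>

text \<open>\<open>h\<close> is the surplus of north over east steps taken before \<open>p\<close>
  begins. Carrying it along turns the prefix condition into a recursion on the first step.\<close>

fun ballot :: "nat \<Rightarrow> 'a step list \<Rightarrow> bool" where
  "ballot h [] \<longleftrightarrow> h = 0"
| "ballot h (North a # p) \<longleftrightarrow> ballot (Suc h) p"
| "ballot 0 (East # p) \<longleftrightarrow> False"
| "ballot (Suc h) (East # p) \<longleftrightarrow> ballot h p"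

lemma All_le_Suc2: "(\<forall>k\<le>Suc m. P k) \<longleftrightarrow> P 0 \<and> (\<forall>k\<le>m. P (Suc k))"
  by (metis Suc_le_mono le0 not0_implies_Suc)

text \<open>Reading one step shifts every prefix by one and changes the surplus by one. An east step
  at surplus 0 already violates the bound at \<open>k = 1\<close>.\<close>

lemma ballot_iff:
  "ballot h p \<longleftrightarrow>
    h + count_list (underlying_path p) (North ()) = count_list (underlying_path p) East \<and>
    (\<forall>k\<le>length p. count_list (take k (underlying_path p)) East
       \<le> h + count_list (take k (underlying_path p)) (North ()))"
  by (induction h p rule: ballot.induct) (auto simp: underlying_path_def All_le_Suc2)

lemma count_list_underlying_path_North:
  "count_list (underlying_path p) (North ()) = length (north_labels p)"
  by (induction p rule: north_labels.induct) (auto simp: underlying_path_def)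

lemma dyck_path_iff_ballot:
  "dyck_path n (underlying_path p) \<longleftrightarrow> length (north_labels p) = n \<and> ballot 0 p"
proof -
  have "length (underlying_path p) = length p"
    by (simp add: underlying_path_def)
  then show ?thesis
    by (auto simp: dyck_path_def ballot_iff count_list_underlying_path_North)
qed

text \<open>Phrased with \<open>successively\<close> rather than indices, so that it unfolds along
  the list. The relation constrains only two adjacent north steps.\<close>

definition increasing_runs :: "nat step list \<Rightarrow> bool" where
  "increasing_runs = successively (\<lambda>s t. \<forall>a b. s = North a \<longrightarrow> t = North b \<longrightarrow> a < b)"

lemma increasing_runs_simps [simp]:
  "increasing_runs []"
  "increasing_runs (East # p) \<longleftrightarrow> increasing_runs p"
  "increasing_runs [North a]"
  "increasing_runs (North a # East # p) \<longleftrightarrow> increasing_runs p"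
  "increasing_runs (North a # North b # p) \<longleftrightarrow> a < b \<and> increasing_runs (North b # p)"
  by (cases p; simp add: increasing_runs_def)+

lemma parking_function_iff:
  "parking_function n p \<longleftrightarrow>
    length (north_labels p) = n \<and> ballot 0 p \<and> distinct (north_labels p) \<and>
    set (north_labels p) = {1..n} \<and> increasing_runs p"
  unfolding parking_function_def dyck_path_iff_ballot increasing_runs_def successively_conv_nth
  by blast

section \<open>Counting labelled paths with a prescribed word of labels\<close>

text \<open>For \<open>h = 0\<close> and \<open>xs\<close> a permutation this is the fibre of
  \<open>phi\<close> over \<open>xs\<close>. General \<open>h\<close> describes the remainder of a
  path that has reached surplus \<open>h\<close>.\<close>

definition labelled_paths :: "nat \<Rightarrow> nat list \<Rightarrow> nat step list set" where
  "labelled_paths h xs = {p. ballot h p \<and> increasing_runs p \<and> north_labels p = xs}"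

lemma north_labels_eq_ConsE:
  assumes "north_labels p = x # xs"
  obtains q where "p = North x # q" "north_labels q = xs"
    | q where "p = East # q" "north_labels q = x # xs"
  using assms by (cases p rule: north_labels.cases) auto

text \<open>After \<open>North x\<close> the path cannot stop, since the surplus is positive, and
  cannot go north, since the next label is not larger. Only an east step remains.\<close>

lemma descent_step:
  assumes "ballot (Suc h) q" "increasing_runs (North x # q)" "north_labels q = xs"
    and "xs \<noteq> [] \<Longrightarrow> \<not> x < hd xs"
  shows "q \<in> (#) East ` labelled_paths h xs"
  using assms by (cases q rule: north_labels.cases) (auto simp: labelled_paths_def)

text \<open>At surplus 0 the first step must be north; the east step forced after it brings the
  surplus back to 0. The last label behaves like a descent.\<close>

lemma labelled_paths_0_descent:
  assumes "xs \<noteq> [] \<Longrightarrow> \<not> x < hd xs"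
  shows "labelled_paths 0 (x # xs) = (\<lambda>p. North x # East # p) ` labelled_paths 0 xs"
proof
  show "labelled_paths 0 (x # xs) \<subseteq> (\<lambda>p. North x # East # p) ` labelled_paths 0 xs"
  proof
    fix p assume p: "p \<in> labelled_paths 0 (x # xs)"
    then have "north_labels p = x # xs" by (simp add: labelled_paths_def)
    then obtain q where q: "p = North x # q" "north_labels q = xs"
      by (rule north_labels_eq_ConsE) (use p in \<open>auto simp: labelled_paths_def\<close>)
    then have "q \<in> (#) East ` labelled_paths 0 xs"
      using p assms by (intro descent_step[of _ _ x]) (auto simp: labelled_paths_def)
    then show "p \<in> (\<lambda>p. North x # East # p) ` labelled_paths 0 xs"
      using q by auto
  qed
qed (auto simp: labelled_paths_def)

text \<open>Either the next label is read at once, with its forced east step, or one unit of surplus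
  is spent first.\<close>

lemma labelled_paths_Suc_descent:
  assumes "xs \<noteq> [] \<Longrightarrow> \<not> x < hd xs"
  shows "labelled_paths (Suc h) (x # xs) =
    (\<lambda>p. North x # East # p) ` labelled_paths (Suc h) xs \<union> (#) East ` labelled_paths h (x # xs)"
    (is "_ = ?A \<union> ?B")
proof
  show "labelled_paths (Suc h) (x # xs) \<subseteq> ?A \<union> ?B"
  proof
    fix p assume p: "p \<in> labelled_paths (Suc h) (x # xs)"
    then have "north_labels p = x # xs" by (simp add: labelled_paths_def)
    then show "p \<in> ?A \<union> ?B"
    proof (cases rule: north_labels_eq_ConsE)
      case (1 q)
      then have "q \<in> (#) East ` labelled_paths (Suc h) xs"
        using p assms by (intro descent_step[of _ _ x]) (auto simp: labelled_paths_def)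
      then show ?thesis using 1 by auto
    next
      case (2 q)
      then show ?thesis using p by (auto simp: labelled_paths_def)
    qed
  qed
qed (auto simp: labelled_paths_def)

text \<open>At an ascent nothing is forced after the first north step, so one unit of surplus is
  carried into the rest.\<close>

lemma labelled_paths_0_ascent:
  assumes "xs \<noteq> [] \<Longrightarrow> x < hd xs"
  shows "labelled_paths 0 (x # xs) = (#) (North x) ` labelled_paths (Suc 0) xs"
proof
  show "labelled_paths 0 (x # xs) \<subseteq> (#) (North x) ` labelled_paths (Suc 0) xs"
  proof
    fix p assume p: "p \<in> labelled_paths 0 (x # xs)"
    then have "north_labels p = x # xs" by (simp add: labelled_paths_def)
    then obtain q where q: "p = North x # q" "north_labels q = xs"
      by (rule north_labels_eq_ConsE) (use p in \<open>auto simp: labelled_paths_def\<close>)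
    have "increasing_runs q"
      using p q by (cases q rule: north_labels.cases) (auto simp: labelled_paths_def)
    then show "p \<in> (#) (North x) ` labelled_paths (Suc 0) xs"
      using p q by (auto simp: labelled_paths_def)
  qed
  show "(#) (North x) ` labelled_paths (Suc 0) xs \<subseteq> labelled_paths 0 (x # xs)"
  proof
    fix p assume "p \<in> (#) (North x) ` labelled_paths (Suc 0) xs"
    then obtain q where q: "p = North x # q" "q \<in> labelled_paths (Suc 0) xs" by blast
    \<comment> \<open>If \<open>q\<close> starts with a north step, its label is
      \<open>hd xs\<close>, so the new adjacent pair is increasing.\<close>
    then show "p \<in> labelled_paths 0 (x # xs)"
      using assms by (cases q rule: north_labels.cases) (auto simp: labelled_paths_def)
  qed
qed

lemma labelled_paths_Nil: "labelled_paths h [] = {replicate h East}"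
proof -
  have "ballot h p \<and> increasing_runs p \<and> north_labels p = [] \<longleftrightarrow> p = replicate h East"
    for p :: "nat step list"
    by (induction h p rule: ballot.induct) (auto simp: Cons_replicate_eq)
  then show ?thesis by (auto simp: labelled_paths_def)
qed

lemma successively_ge_ConsD:
  assumes "successively (\<ge>) (x # xs :: nat list)"
  shows "xs \<noteq> [] \<Longrightarrow> \<not> x < hd xs" "successively (\<ge>) xs"
  using assms by (auto simp: successively_Cons)

text \<open>Every label is followed by exactly one forced east step, so the path alternates north
  and east.\<close>

lemma card_labelled_paths_0_decreasing:
  assumes "successively (\<ge>) xs"
  shows "card (labelled_paths 0 xs) = 1"
  using assms
proof (induction xs)
  case Nil
  then show ?case by (simp add: labelled_paths_Nil)
next
  case (Cons x xs)
  note dec = successively_ge_ConsD[OF Cons.prems]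
  show ?case
    using Cons.IH[OF dec(2)]
    by (subst labelled_paths_0_descent[OF dec(1)]) (simp_all add: card_image inj_on_def)
qed

text \<open>The one surplus east step can be spent before any of the labels or after the last block,
  and everything else is forced.\<close>

lemma card_labelled_paths_1_decreasing:
  assumes "successively (\<ge>) xs"
  shows "card (labelled_paths (Suc 0) xs) = Suc (length xs)"
  using assms
proof (induction xs)
  case Nil
  then show ?case by (simp add: labelled_paths_Nil)
next
  case (Cons x xs)
  note dec = successively_ge_ConsD[OF Cons.prems]
  have IH: "card (labelled_paths (Suc 0) xs) = Suc (length xs)"
    using Cons.IH dec(2) by blast
  have one: "card (labelled_paths 0 (x # xs)) = 1"
    using card_labelled_paths_0_decreasing Cons.prems by blast
  \<comment> \<open>A set of positive cardinality is finite. The two parts of the union are disjoint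
    because their paths differ in the first step.\<close>
  have "finite (labelled_paths (Suc 0) xs)" "finite (labelled_paths 0 (x # xs))"
    using IH one by (auto intro: card_ge_0_finite)
  then have "card ((\<lambda>p. North x # East # p) ` labelled_paths (Suc 0) xs \<union>
        (#) East ` labelled_paths 0 (x # xs)) =
      card ((\<lambda>p. North x # East # p) ` labelled_paths (Suc 0) xs) +
      card ((#) East ` labelled_paths 0 (x # xs))"
    by (intro card_Un_disjoint) auto
  then have "card (labelled_paths (Suc 0) (x # xs)) =
      card ((\<lambda>p. North x # East # p) ` labelled_paths (Suc 0) xs) +
      card ((#) East ` labelled_paths 0 (x # xs))"
    using labelled_paths_Suc_descent[of xs x 0] dec(1) by simp
  then show ?case
    using IH one by (simp add: card_image inj_on_def)
qed

text \<open>The first \<open>i - 1\<close> labels are forced blocks of a north and an east step.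
  After label \<open>i\<close> one surplus step is placed among the remaining
  \<open>length xs - i\<close> labels. The value \<open>i = length xs\<close> encodes the absence of
  an ascent.\<close>

lemma card_labelled_paths_unique_ascent:
  assumes "1 \<le> i" "i \<le> length xs"
    and "\<And>j. Suc j < length xs \<Longrightarrow> xs ! j < xs ! Suc j \<longleftrightarrow> Suc j = i"
  shows "card (labelled_paths 0 xs) = Suc (length xs) - i"
  using assms
proof (induction xs arbitrary: i)
  case Nil
  then show ?case by simp
next
  case (Cons x xs)
  have head: "x < hd xs \<longleftrightarrow> i = 1" if "xs \<noteq> []"
    using Cons.prems(3)[of 0] that by (auto simp: hd_conv_nth)
  have tail: "xs ! j < xs ! Suc j \<longleftrightarrow> Suc (Suc j) = i" if "Suc j < length xs" for j
    using Cons.prems(3)[of "Suc j"] that by auto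
  show ?case
  proof (cases "i = 1")
    case True
    then have "successively (\<ge>) xs"
      using tail by (fastforce simp: successively_conv_nth not_less)
    \<comment> \<open>For \<open>xs = []\<close> the ascent condition holds vacuously, and the same
      formula gives 1.\<close>
    then show ?thesis
      using True head
      by (simp add: labelled_paths_0_ascent card_image card_labelled_paths_1_decreasing)
  next
    case False
    then obtain k where k: "i = Suc k" "1 \<le> k" using Cons.prems(1) by (cases i) auto
    have "card (labelled_paths 0 xs) = Suc (length xs) - k"
      using Cons.prems(2) tail k by (intro Cons.IH) auto
    then show ?thesis
      using False head k by (simp add: labelled_paths_0_descent card_image inj_on_def)
  qed
qed

section \<open>Permutations and their relative order\<close>

text \<open>The smaller values are exactly \<open>{1..<xs ! j}\<close>, and each of them occurs at a
  single position.\<close>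

lemma permutation_list_nth_eq_card:
  assumes "distinct xs" "set xs = {1..n}" "j < length xs"
  shows "xs ! j = Suc (card {k. k < length xs \<and> xs ! k < xs ! j})"
proof -
  have "xs ! j \<in> {1..n}"
    using assms nth_mem by blast
  then have j: "1 \<le> xs ! j" "xs ! j \<le> n"
    by auto
  have "(!) xs ` {k. k < length xs \<and> xs ! k < xs ! j} = {y \<in> set xs. y < xs ! j}"
    by (auto simp: in_set_conv_nth)
  also have "\<dots> = {1..<xs ! j}"
    using assms(2) j by auto
  finally have "card ((!) xs ` {k. k < length xs \<and> xs ! k < xs ! j}) = xs ! j - 1"
    by simp
  moreover have "inj_on ((!) xs) {k. k < length xs \<and> xs ! k < xs ! j}"
    using assms(1) by (auto intro: inj_on_nth)
  ultimately show ?thesis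
    using j by (simp add: card_image)
qed

text \<open>Each entry is the number of smaller entries plus one, hence is recovered from
  comparisons. Distinctness reduces these to pairs with \<open>j < k\<close>.\<close>

lemma permutation_list_eqI:
  assumes xs: "distinct xs" "set xs = {1..n}" and ys: "distinct ys" "set ys = {1..n}"
    and less: "\<And>j k. j < k \<Longrightarrow> k < n \<Longrightarrow> xs ! j < xs ! k \<longleftrightarrow> ys ! j < ys ! k"
  shows "xs = ys"
proof (rule nth_equalityI)
  have len: "length xs = n" "length ys = n"
    using distinct_card[OF xs(1)] distinct_card[OF ys(1)] xs ys by auto
  then show "length xs = length ys" by simp
  fix j assume j: "j < length xs"
  have "xs ! k < xs ! j \<longleftrightarrow> ys ! k < ys ! j" if "k < n" for k
  proof (cases k j rule: linorder_cases)
    case greater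
    then have "xs ! k \<noteq> xs ! j" "ys ! k \<noteq> ys ! j"
      using that len xs ys by (auto simp: nth_eq_iff_index_eq)
    then show ?thesis
      using less[OF greater that] by auto
  qed (use less[of k j] j len in auto)
  then have "{k. k < length xs \<and> xs ! k < xs ! j} = {k. k < length ys \<and> ys ! k < ys ! j}"
    using len by auto
  then show "xs ! j = ys ! j"
    using permutation_list_nth_eq_card[OF xs j] permutation_list_nth_eq_card[OF ys, of j] j len
    by simp
qed

section \<open>Summation over the avoiding permutations\<close>

lemma sum_Suc_diff_eq_choose: "(\<Sum>i=1..n. Suc n - i) = (n + 1) choose 2"
proof -
  have "(\<Sum>i=1..n. Suc n - i) = (\<Sum>i=1..n. i)"
    by (rule sum.reindex_bij_witness[of _ "\<lambda>i. Suc n - i" "\<lambda>i. Suc n - i"]) auto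
  also have "\<dots> = (n + 1) choose 2"
    by (induction n) (auto simp: numeral_2_eq_2)
  finally show ?thesis .
qed

text \<open>
  Here \<open>f i j\<close> is the entry of \<open>\<sigma>\<^sub>i\<close> at the 0-based position \<open>j\<close>, and \<open>T i\<close> is the set of
  pairs of positions at which \<open>\<sigma>\<^sub>i\<close> increases, which determines \<open>\<sigma>\<^sub>i\<close>.
\<close>

lemma pf_eq_choose_if_unique_ascents:
  fixes f :: "nat \<Rightarrow> nat \<Rightarrow> nat" and T :: "nat \<Rightarrow> nat \<Rightarrow> nat \<Rightarrow> bool"
  assumes range: "\<And>i j. i \<in> {1..n} \<Longrightarrow> j < n \<Longrightarrow> f i j \<in> {1..n}"
    and inj: "\<And>i j k. i \<in> {1..n} \<Longrightarrow> j < k \<Longrightarrow> k < n \<Longrightarrow> f i j \<noteq> f i k"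
    and less: "\<And>i j k. i \<in> {1..n} \<Longrightarrow> j < k \<Longrightarrow> k < n \<Longrightarrow> f i j < f i k \<longleftrightarrow> T i j k"
    and ascent: "\<And>i j. i \<in> {1..n} \<Longrightarrow> Suc j < n \<Longrightarrow> T i j (Suc j) \<longleftrightarrow> Suc j = i"
    and avoid: "\<And>\<pi>. distinct \<pi> \<Longrightarrow> set \<pi> = {1..n} \<Longrightarrow> length \<pi> = n \<Longrightarrow>
      (\<forall>\<rho>\<in>R. avoids \<pi> \<rho>) \<longleftrightarrow>
      (\<exists>i\<in>{1..n}. \<forall>j k. j < k \<longrightarrow> k < n \<longrightarrow> (\<pi> ! j < \<pi> ! k \<longleftrightarrow> T i j k))"
  shows "pf n R = (n + 1) choose 2"
proof -
  define \<sigma> where "\<sigma> i = map (f i) [0..<n]" for i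
  have len: "length (\<sigma> i) = n" for i by (simp add: \<sigma>_def)
  have less\<sigma>: "\<sigma> i ! j < \<sigma> i ! k \<longleftrightarrow> T i j k" if "i \<in> {1..n}" "j < k" "k < n" for i j k
    using less that by (simp add: \<sigma>_def)
  have inj_f: "inj_on (f i) {0..<n}" if "i \<in> {1..n}" for i
    using inj[OF that] by (intro linorder_inj_onI) auto
  have dist: "distinct (\<sigma> i)" if "i \<in> {1..n}" for i
    using inj_f[OF that] by (simp add: \<sigma>_def distinct_map)
  have set\<sigma>: "set (\<sigma> i) = {1..n}" if "i \<in> {1..n}" for i
  \<comment> \<open>By counting: \<open>n\<close> distinct values inside \<open>{1..n}\<close> fill
    it.\<close>
  proof (rule card_subset_eq)
    show "set (\<sigma> i) \<subseteq> {1..n}" using range[OF that] by (auto simp: \<sigma>_def)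
    show "card (set (\<sigma> i)) = card {1..n}"
      using dist[OF that] by (simp add: distinct_card len)
  qed simp
  have ascents: "\<sigma> i ! j < \<sigma> i ! Suc j \<longleftrightarrow> Suc j = i" if "i \<in> {1..n}" "Suc j < n" for i j
    using less\<sigma>[of i j "Suc j"] ascent that by simp
  have inj\<sigma>: "i = i'" if "i \<in> {1..n}" "i' \<in> {1..n}" "\<sigma> i = \<sigma> i'" for i i'
    using that
  proof (induction i i' rule: linorder_wlog)
    case (le a b)
    show ?case
    proof (rule ccontr)
      assume "a \<noteq> b"
      \<comment> \<open>From \<open>a < b\<close> and \<open>b \<le> n\<close>, position
        \<open>a - 1\<close> has a successor in range. There \<open>\<sigma> a\<close> ascends and
        \<open>\<sigma> b\<close> does not.\<close>
      then have "Suc (a - 1) = a" "Suc (a - 1) < n" using le by auto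
      then show False using ascents[of a "a - 1"] ascents[of b "a - 1"] le \<open>a \<noteq> b\<close> by auto
    qed
  qed auto
  have "{p. parking_function n p \<and> (\<forall>\<rho>\<in>R. avoids (phi p) \<rho>)} =
      (\<Union>i\<in>{1..n}. labelled_paths 0 (\<sigma> i))" (is "?L = ?U")
  proof
    show "?L \<subseteq> ?U"
    proof
      fix p assume p: "p \<in> ?L"
      let ?\<pi> = "north_labels p"
      have perm: "distinct ?\<pi>" "set ?\<pi> = {1..n}" "length ?\<pi> = n"
        using p by (auto simp: parking_function_iff)
      then obtain i where i: "i \<in> {1..n}"
        and *: "\<And>j k. j < k \<Longrightarrow> k < n \<Longrightarrow> ?\<pi> ! j < ?\<pi> ! k \<longleftrightarrow> T i j k"
        using p avoid[OF perm] by (auto simp: phi_def)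
      have "?\<pi> = \<sigma> i"
        by (rule permutation_list_eqI[OF perm(1,2) dist[OF i] set\<sigma>[OF i]])
          (simp add: * less\<sigma>[OF i])
      then show "p \<in> ?U"
        using p i by (auto simp: labelled_paths_def parking_function_iff)
    qed
    show "?U \<subseteq> ?L"
    proof
      fix p assume "p \<in> ?U"
      then obtain i where i: "i \<in> {1..n}" and p: "p \<in> labelled_paths 0 (\<sigma> i)" by blast
      have "\<forall>\<rho>\<in>R. avoids (\<sigma> i) \<rho>"
        unfolding avoid[OF dist[OF i] set\<sigma>[OF i] len] using i less\<sigma>[OF i] by blast
      then show "p \<in> ?L"
        using p dist[OF i] set\<sigma>[OF i] len
        by (auto simp: labelled_paths_def parking_function_iff phi_def)
    qed
  qed
  then have "pf n R = card (\<Union>i\<in>{1..n}. labelled_paths 0 (\<sigma> i))"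
    by (simp add: pf_def)
  also have "\<dots> = (\<Sum>i=1..n. card (labelled_paths 0 (\<sigma> i)))"
  proof (rule card_UN_disjoint)
    have "card (labelled_paths 0 (\<sigma> i)) > 0" if "i \<in> {1..n}" for i
      using that ascents by (subst card_labelled_paths_unique_ascent[of i]) (auto simp: len)
    then show "\<forall>i\<in>{1..n}. finite (labelled_paths 0 (\<sigma> i))"
      using card_ge_0_finite by blast
    show "\<forall>i\<in>{1..n}. \<forall>j\<in>{1..n}. i \<noteq> j \<longrightarrow>
        labelled_paths 0 (\<sigma> i) \<inter> labelled_paths 0 (\<sigma> j) = {}"
      \<comment> \<open>A common path would read both \<open>\<sigma> i\<close> and
        \<open>\<sigma> j\<close>, forcing \<open>i = j\<close>.\<close>
      using inj\<sigma> by (fastforce simp: labelled_paths_def)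
  qed simp
  also have "\<dots> = (\<Sum>i=1..n. Suc n - i)"
    using ascents by (intro sum.cong refl, subst card_labelled_paths_unique_ascent) (auto simp: len)
  finally show ?thesis by (simp only: sum_Suc_diff_eq_choose)
qed

section \<open>Patterns of length three\<close>

text \<open>The index function becomes three explicit positions. Since all entries are distinct, the
  three strict comparisons determine every weak one in the definition.\<close>

lemma contains_three_iff:
  assumes "distinct \<pi>" "a \<noteq> b" "a \<noteq> c" "b \<noteq> c"
  shows "contains \<pi> [a, b, c] \<longleftrightarrow>
    (\<exists>x y z. x < y \<and> y < z \<and> z < length \<pi> \<and> (\<pi> ! x < \<pi> ! y \<longleftrightarrow> a < b) \<and>
      (\<pi> ! x < \<pi> ! z \<longleftrightarrow> a < c) \<and> (\<pi> ! y < \<pi> ! z \<longleftrightarrow> b < c))" (is "_ \<longleftrightarrow> ?R")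
proof
  assume "contains \<pi> [a, b, c]"
  then obtain i :: "nat \<Rightarrow> nat" where i: "strict_mono_on {..<3} i" "\<forall>s<3. i s < length \<pi>"
    "\<forall>s<3. \<forall>t<3. \<pi> ! i s \<le> \<pi> ! i t \<longleftrightarrow> [a, b, c] ! s \<le> [a, b, c] ! t"
    by (auto simp: contains_def numeral_3_eq_3)
  have "i 0 < i 1" "i 1 < i 2"
    using i(1) by (auto simp: strict_mono_on_def)
  moreover have "i 2 < length \<pi>" using i(2) by simp
  moreover have "\<pi> ! i 0 < \<pi> ! i 1 \<longleftrightarrow> a < b" "\<pi> ! i 0 < \<pi> ! i 2 \<longleftrightarrow> a < c"
    "\<pi> ! i 1 < \<pi> ! i 2 \<longleftrightarrow> b < c"
    using i(3)[rule_format, of 1 0] i(3)[rule_format, of 2 0] i(3)[rule_format, of 2 1]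
    by (auto simp: not_le[symmetric])
  ultimately show ?R by blast
next
  assume ?R
  then obtain x y z where xyz: "x < y" "y < z" "z < length \<pi>" "\<pi> ! x < \<pi> ! y \<longleftrightarrow> a < b"
    "\<pi> ! x < \<pi> ! z \<longleftrightarrow> a < c" "\<pi> ! y < \<pi> ! z \<longleftrightarrow> b < c" by blast
  have "\<pi> ! x \<noteq> \<pi> ! y" "\<pi> ! x \<noteq> \<pi> ! z" "\<pi> ! y \<noteq> \<pi> ! z"
    using xyz assms(1) by (auto simp: nth_eq_iff_index_eq)
  then have le: "\<pi> ! x \<le> \<pi> ! y \<longleftrightarrow> a \<le> b" "\<pi> ! x \<le> \<pi> ! z \<longleftrightarrow> a \<le> c" "\<pi> ! y \<le> \<pi> ! z \<longleftrightarrow> b \<le> c"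
    "\<pi> ! y \<le> \<pi> ! x \<longleftrightarrow> b \<le> a" "\<pi> ! z \<le> \<pi> ! x \<longleftrightarrow> c \<le> a" "\<pi> ! z \<le> \<pi> ! y \<longleftrightarrow> c \<le> b"
    using xyz assms by linarith+
  have all3: "(\<forall>s<length [a, b, c]. P s) \<longleftrightarrow> P 0 \<and> P 1 \<and> P 2" for P :: "nat \<Rightarrow> bool"
    by (auto simp: less_Suc_eq numeral_2_eq_2)
  have "strict_mono_on {..<length [a, b, c]} ((!) [x, y, z])"
    using xyz(1,2) by (auto simp: strict_mono_on_def less_Suc_eq)
  then show "contains \<pi> [a, b, c]"
    unfolding contains_def all3
    using xyz(1-3) le by (intro exI[of _ "(!) [x, y, z]"]) simp
qed

lemma avoids_three_iff:
  assumes "distinct \<pi>" "a \<noteq> b" "a \<noteq> c" "b \<noteq> c"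
  shows "avoids \<pi> [a, b, c] \<longleftrightarrow>
    (\<forall>x y z. x < y \<longrightarrow> y < z \<longrightarrow> z < length \<pi> \<longrightarrow> \<not> ((\<pi> ! x < \<pi> ! y \<longleftrightarrow> a < b) \<and>
      (\<pi> ! x < \<pi> ! z \<longleftrightarrow> a < c) \<and> (\<pi> ! y < \<pi> ! z \<longleftrightarrow> b < c)))"
  unfolding avoids_def contains_three_iff[OF assms] by blast

section \<open>Structure of the three avoidance classes\<close>

lemma permutation_list_obtain_max:
  assumes "n \<ge> 1" "distinct \<pi>" "set \<pi> = {1..n}" "length \<pi> = n"
  obtains m where "m < n" "\<And>j. j < n \<Longrightarrow> j \<noteq> m \<Longrightarrow> \<pi> ! j < \<pi> ! m"
proof -
  have "n \<in> set \<pi>" using assms by simp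
  then obtain m where m: "m < n" "\<pi> ! m = n" using assms(4) by (auto simp: in_set_conv_nth)
  have "\<pi> ! j < \<pi> ! m" if "j < n" "j \<noteq> m" for j
  proof -
    have "\<pi> ! j \<in> set \<pi>" using that assms(4) by simp
    moreover have "\<pi> ! j \<noteq> \<pi> ! m"
      using nth_eq_iff_index_eq[OF assms(2), of j m] that assms(4) m(1) by simp
    ultimately show ?thesis using m assms(3) by auto
  qed
  then show ?thesis using m(1) that by blast
qed

lemma permutation_list_obtain_min:
  assumes "n \<ge> 1" "distinct \<pi>" "set \<pi> = {1..n}" "length \<pi> = n"
  obtains m where "m < n" "\<And>j. j < n \<Longrightarrow> j \<noteq> m \<Longrightarrow> \<pi> ! m < \<pi> ! j"
proof -
  have "1 \<in> set \<pi>" using assms by simp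
  then obtain m where m: "m < n" "\<pi> ! m = 1" using assms(4) by (auto simp: in_set_conv_nth)
  have "\<pi> ! m < \<pi> ! j" if "j < n" "j \<noteq> m" for j
  proof -
    have "\<pi> ! j \<in> set \<pi>" using that assms(4) by simp
    moreover have "\<pi> ! j \<noteq> \<pi> ! m"
      using nth_eq_iff_index_eq[OF assms(2), of j m] that assms(4) m(1) by simp
    ultimately show ?thesis using m assms(3) by auto
  qed
  then show ?thesis using m(1) that by blast
qed

text \<open>Every increasing pair must end at the maximum: otherwise the pair and the maximum form
  312, 132 or 123, as the maximum lies before, between or after its positions.\<close>

lemma avoids_123_132_312_iff:
  assumes "n \<ge> 1" "distinct \<pi>" "set \<pi> = {1..n}" "length \<pi> = n"
  shows "(\<forall>\<rho>\<in>{[1,2,3], [1,3,2], [3,1,2]}. avoids \<pi> \<rho>) \<longleftrightarrow>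
    (\<exists>i\<in>{1..n}. \<forall>j k. j < k \<longrightarrow> k < n \<longrightarrow> (\<pi> ! j < \<pi> ! k \<longleftrightarrow> k = i))" (is "?L \<longleftrightarrow> ?R")
proof
  assume L: ?L
  have no123: "\<not> (\<pi> ! x < \<pi> ! y \<and> \<pi> ! x < \<pi> ! z \<and> \<pi> ! y < \<pi> ! z)"
    if "x < y" "y < z" "z < n" for x y z
    using L that assms by (auto simp: avoids_three_iff)
  have no132: "\<not> (\<pi> ! x < \<pi> ! y \<and> \<pi> ! x < \<pi> ! z \<and> \<not> \<pi> ! y < \<pi> ! z)"
    if "x < y" "y < z" "z < n" for x y z
    using L that assms by (auto simp: avoids_three_iff)
  have no312: "\<not> (\<not> \<pi> ! x < \<pi> ! y \<and> \<not> \<pi> ! x < \<pi> ! z \<and> \<pi> ! y < \<pi> ! z)"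
    if "x < y" "y < z" "z < n" for x y z
    using L that assms by (auto simp: avoids_three_iff)
  obtain m where m: "m < n" and max: "\<And>j. j < n \<Longrightarrow> j \<noteq> m \<Longrightarrow> \<pi> ! j < \<pi> ! m"
    using permutation_list_obtain_max[OF assms] by blast
  have *: "\<not> \<pi> ! j < \<pi> ! k" if "j < k" "k < n" "k \<noteq> m" for j k
  proof -
    consider "m < j" | "m = j" | "j < m" "m < k" | "k < m" using \<open>k \<noteq> m\<close> by linarith
    then show ?thesis
      using no312[of m j k] no132[of j m k] no123[of j k m] max[of j] max[of k] m that
      by cases auto
  qed
  show ?R
  \<comment> \<open>A maximum in front leaves no increasing pair. This is encoded by
    \<open>i = n\<close>, which no \<open>k < n\<close> attains.\<close>
  proof (intro bexI[of _ "if m = 0 then n else m"] allI impI)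
    fix j k assume "j < k" "k < n"
    then show "\<pi> ! j < \<pi> ! k \<longleftrightarrow> k = (if m = 0 then n else m)"
      using *[of j k] max[of j] max[of k] by auto
  qed (use m in auto)
next
  assume ?R
  \<comment> \<open>In 123 and 132 two increasing pairs end at different positions; in 312 the last
    entry exceeds the middle one but not the first.\<close>
  then show ?L using assms by (auto simp: avoids_three_iff)
qed

text \<open>Every increasing pair must start at the minimum: otherwise the pair and the minimum form
  123, 213 or 231, as the minimum lies before, between or after its positions.\<close>

lemma avoids_123_213_231_iff:
  assumes "n \<ge> 1" "distinct \<pi>" "set \<pi> = {1..n}" "length \<pi> = n"
  shows "(\<forall>\<rho>\<in>{[1,2,3], [2,1,3], [2,3,1]}. avoids \<pi> \<rho>) \<longleftrightarrow>
    (\<exists>i\<in>{1..n}. \<forall>j k. j < k \<longrightarrow> k < n \<longrightarrow> (\<pi> ! j < \<pi> ! k \<longleftrightarrow> Suc j = i))" (is "?L \<longleftrightarrow> ?R")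
proof
  assume L: ?L
  have no123: "\<not> (\<pi> ! x < \<pi> ! y \<and> \<pi> ! x < \<pi> ! z \<and> \<pi> ! y < \<pi> ! z)"
    if "x < y" "y < z" "z < n" for x y z
    using L that assms by (auto simp: avoids_three_iff)
  have no213: "\<not> (\<not> \<pi> ! x < \<pi> ! y \<and> \<pi> ! x < \<pi> ! z \<and> \<pi> ! y < \<pi> ! z)"
    if "x < y" "y < z" "z < n" for x y z
    using L that assms by (auto simp: avoids_three_iff)
  have no231: "\<not> (\<pi> ! x < \<pi> ! y \<and> \<not> \<pi> ! x < \<pi> ! z \<and> \<not> \<pi> ! y < \<pi> ! z)"
    if "x < y" "y < z" "z < n" for x y z
    using L that assms by (auto simp: avoids_three_iff)
  obtain m where m: "m < n" and min: "\<And>j. j < n \<Longrightarrow> j \<noteq> m \<Longrightarrow> \<pi> ! m < \<pi> ! j"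
    using permutation_list_obtain_min[OF assms] by blast
  have *: "\<not> \<pi> ! j < \<pi> ! k" if "j < k" "k < n" "j \<noteq> m" for j k
  proof -
    consider "m < j" | "j < m" "m < k" | "m = k" | "k < m" using \<open>j \<noteq> m\<close> by linarith
    then show ?thesis
      using no123[of m j k] no213[of j m k] no231[of j k m] min[of j] min[of k] m that
      by cases auto
  qed
  show ?R
  \<comment> \<open>The index \<open>i\<close> counts positions from 1, \<open>m\<close> from 0. A
    minimum at the end gives \<open>i = n\<close>, with no later position to ascend to.\<close>
  proof (intro bexI[of _ "Suc m"] allI impI)
    fix j k assume "j < k" "k < n"
    then show "\<pi> ! j < \<pi> ! k \<longleftrightarrow> Suc j = (Suc m)"
      using *[of j k] min[of j] min[of k] by auto
  qed (use m in auto)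
next
  assume ?R
  then show ?L using assms by (auto simp: avoids_three_iff)
qed

text \<open>The entries before the maximum decrease by 123, those from the maximum on by 312, and
  231 puts the first block entirely below the second.\<close>

lemma avoids_123_231_312_iff:
  assumes "n \<ge> 1" "distinct \<pi>" "set \<pi> = {1..n}" "length \<pi> = n"
  shows "(\<forall>\<rho>\<in>{[1,2,3], [2,3,1], [3,1,2]}. avoids \<pi> \<rho>) \<longleftrightarrow>
    (\<exists>i\<in>{1..n}. \<forall>j k. j < k \<longrightarrow> k < n \<longrightarrow> (\<pi> ! j < \<pi> ! k \<longleftrightarrow> j < i \<and> i \<le> k))" (is "?L \<longleftrightarrow> ?R")
proof
  assume L: ?L
  have no123: "\<not> (\<pi> ! x < \<pi> ! y \<and> \<pi> ! x < \<pi> ! z \<and> \<pi> ! y < \<pi> ! z)"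
    if "x < y" "y < z" "z < n" for x y z
    using L that assms by (auto simp: avoids_three_iff)
  have no231: "\<not> (\<pi> ! x < \<pi> ! y \<and> \<not> \<pi> ! x < \<pi> ! z \<and> \<not> \<pi> ! y < \<pi> ! z)"
    if "x < y" "y < z" "z < n" for x y z
    using L that assms by (auto simp: avoids_three_iff)
  have no312: "\<not> (\<not> \<pi> ! x < \<pi> ! y \<and> \<not> \<pi> ! x < \<pi> ! z \<and> \<pi> ! y < \<pi> ! z)"
    if "x < y" "y < z" "z < n" for x y z
    using L that assms by (auto simp: avoids_three_iff)
  obtain m where m: "m < n" and max: "\<And>j. j < n \<Longrightarrow> j \<noteq> m \<Longrightarrow> \<pi> ! j < \<pi> ! m"
    using permutation_list_obtain_max[OF assms] by blast
  have *: "\<pi> ! j < \<pi> ! k \<longleftrightarrow> j < m \<and> m \<le> k" if "j < k" "k < n" for j k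
  proof -
    consider "m < j" | "m = j" | "j < m" "m < k" | "m = k" | "k < m" by linarith
    then show ?thesis
      using no312[of m j k] no231[of j m k] no123[of j k m] max[of j] max[of k] m that
      by cases auto
  qed
  show ?R
  \<comment> \<open>If the maximum comes first, the first block is empty and the word decreases;
    \<open>i = n\<close> describes the same word as a single block.\<close>
  proof (intro bexI[of _ "if m = 0 then n else m"] allI impI)
    fix j k assume "j < k" "k < n"
    then show "\<pi> ! j < \<pi> ! k \<longleftrightarrow> j < (if m = 0 then n else m) \<and> (if m = 0 then n else m) \<le> k"
      using *[of j k] max[of j] max[of k] by auto
  qed (use m in auto)
next
  assume ?R
  then show ?L using assms by (auto simp: avoids_three_iff)
qed

theorem theorem9:
  fixes n :: nat
  assumes "n \<ge> 1"
  shows "pf n {[1,2,3], [1,3,2], [3,1,2]} = pf n {[1,2,3], [2,1,3], [2,3,1]} \<and>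
         pf n {[1,2,3], [2,1,3], [2,3,1]} = pf n {[1,2,3], [2,3,1], [3,1,2]} \<and>
         pf n {[1,2,3], [2,3,1], [3,1,2]} = (n + 1) choose 2"
proof -
  \<comment> \<open>For \<open>i < n\<close> the word is
    \<open>n-1, ..., n-i, n, n-i-1, ..., 1\<close>, with the maximum at 0-based position
    \<open>i\<close>. For \<open>i = n\<close> it is \<open>n, ..., 1\<close>.\<close>
  have "pf n {[1,2,3], [1,3,2], [3,1,2]} = (n + 1) choose 2"
    by (rule pf_eq_choose_if_unique_ascents[
          where T = "\<lambda>i j k. k = i" and
            f = "\<lambda>i j. if j = i then n else if j < i \<and> i < n then n - 1 - j else n - j",
          OF _ _ _ _ avoids_123_132_312_iff[OF assms]])
      auto
  \<comment> \<open>The word is \<open>n, ..., n-i+2, 1, n-i+1, ..., 2\<close>, with the minimum at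
    0-based position \<open>i - 1\<close>.\<close>
  moreover have "pf n {[1,2,3], [2,1,3], [2,3,1]} = (n + 1) choose 2"
    by (rule pf_eq_choose_if_unique_ascents[
          where T = "\<lambda>i j k. Suc j = i" and
            f = "\<lambda>i j. if Suc j = i then 1 else if Suc j < i then n - j else Suc n - j",
          OF _ _ _ _ avoids_123_213_231_iff[OF assms]])
      auto
  \<comment> \<open>The word is \<open>i, ..., 1, n, ..., i+1\<close>; its second block is empty for
    \<open>i = n\<close>.\<close>
  moreover have "pf n {[1,2,3], [2,3,1], [3,1,2]} = (n + 1) choose 2"
    by (rule pf_eq_choose_if_unique_ascents[
          where T = "\<lambda>i j k. j < i \<and> i \<le> k" and
            f = "\<lambda>i j. if j < i then i - j else n + i - j",
          OF _ _ _ _ avoids_123_231_312_iff[OF assms]])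
      auto
  ultimately show ?thesis by simp
qed

end
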